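(* Let $D_n$ be the digraph obtained from the $n$-dimensional hypercube $C_n$ by adding, for each vertex $v=(v_1,\ldots,v_n)\in\{0,1\}^n$, a diagonal arc from $v$ to its antipodal vertex $(1-v_1,\ldots,1-v_n)$. Weight each diagonal arc by $y$ and each non-diagonal arc of direction $i$ and spin $\varepsilon$ by $x_{i,\varepsilon}$. Then $$F_{D_n}(t;\mathbf{x},y):=\sum_{F}t^{k(F)}\prod_{a\in F}w(a)=\prod_{S\subseteq[n]}\Big(t+2y\cdot\mathbf{1}_{|S|\text{ odd}}+\sum_{i\in S}(x_{i,0}+x_{i,1})\Big),$$ where the sum is over all rooted forests $F$ of $D_n$, $k(F)$ is the number of trees of $F$, and $w(a)$ is the weight of the arc $a$.
   Context: The hypercube $C_n$ has vertex set $\{0,1\}^n$ with two vertices adjacent when they differ in exactly one coordinate; it is viewed as a digraph by replacing each edge by two opposite arcs. A non-diagonal arc $(u,v)$ has direction $i$ and spin $\varepsilon$ if $v$ is obtained from $u$ by changing the $i$th coordinate from $1-\varepsilon$ to $\varepsilon$. A rooted forest of a digraph is a subgraph containing every vertex, containing no cycle, in which each vertex has at most one outgoing arc. $\mathbf{x}=(x_{1,0},x_{1,1},\ldots,x_{n,0},x_{n,1})$ and $y$ are indeterminates; $\mathbf{1}_{|S|\text{ odd}}$ is $1$ if $|S|$ is odd and $0$ otherwise. *)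

theory Defs
  imports "Graph_Theory.Digraph_Component" "HOL-Library.Poly_Mapping" "HOL-Library.FuncSet"
begin

section \<open>Rooted forests of a finite directed multigraph\<close>

text \<open>
  \<^const>\<open>forest\<close> excludes directed cycles (loops included), and \<^const>\<open>spanning\<close> says that
  \<open>F\<close> is a subgraph of \<open>D\<close> containing every vertex.  Only meant for finite \<open>D\<close>, as
  \<^const>\<open>out_degree\<close> is a cardinality.
\<close>
definition rooted_forest :: "('v, 'e) pre_digraph \<Rightarrow> ('v, 'e) pre_digraph \<Rightarrow> bool" where
  "rooted_forest D F \<longleftrightarrow> spanning F D \<and> forest F \<and> (\<forall>v \<in> verts F. out_degree F v \<le> 1)"

text \<open>
  The trees of a forest are its (weakly) connected components, that is, its maximal connected
  subgraphs; \<^const>\<open>Digraph_Component.connected\<close> ignores the orientation of the arcs.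
\<close>
definition trees :: "('v, 'e) pre_digraph \<Rightarrow> ('v, 'e) pre_digraph set" where
  "trees F = {T. pre_digraph.max_subgraph F Digraph_Component.connected T}"

definition forest_enumerator ::
    "('v, 'e) pre_digraph \<Rightarrow> ('e \<Rightarrow> 'r) \<Rightarrow> 'r \<Rightarrow> 'r :: comm_semiring_1" where
  "forest_enumerator D w t =
     (\<Sum>F | rooted_forest D F. t ^ card (trees F) * (\<Prod>a \<in> arcs F. w a))"

section \<open>The hypercube with its diagonal arcs\<close>

type_synonym vertex = "nat \<Rightarrow> nat"

definition cube_verts :: "nat \<Rightarrow> vertex set" where
  "cube_verts n = {1..n} \<rightarrow>\<^sub>E {0, 1}"

definition cube_adj :: "nat \<Rightarrow> vertex \<Rightarrow> vertex \<Rightarrow> bool" where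
  "cube_adj n u v \<longleftrightarrow>
     u \<in> cube_verts n \<and> v \<in> cube_verts n \<and> card {i \<in> {1..n}. u i \<noteq> v i} = 1"

definition antipode :: "nat \<Rightarrow> vertex \<Rightarrow> vertex" where
  "antipode n v = (\<lambda>i \<in> {1..n}. 1 - v i)"

text \<open>
  Both kinds of arc carry their tail and their head.  The constructors keep the two kinds apart:
  for \<open>n = 1\<close> the diagonal arcs are parallel to the arcs of the hypercube.  (For \<open>n = 0\<close> the only
  arc is a diagonal loop, which lies in no forest.)
\<close>
datatype arc = Cube vertex vertex | Diag vertex vertex

fun arc_tail :: "arc \<Rightarrow> vertex" where
  "arc_tail (Cube u v) = u"
| "arc_tail (Diag u v) = u"

fun arc_head :: "arc \<Rightarrow> vertex" where
  "arc_head (Cube u v) = v"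
| "arc_head (Diag u v) = v"

definition diag_cube :: "nat \<Rightarrow> (vertex, arc) pre_digraph" where
  "diag_cube n =
     \<lparr> verts = cube_verts n,
       arcs = {Cube u v | u v. cube_adj n u v} \<union> {Diag v (antipode n v) | v. v \<in> cube_verts n},
       tail = arc_tail,
       head = arc_head \<rparr>"

definition direction :: "vertex \<Rightarrow> vertex \<Rightarrow> nat" where
  "direction u v = (THE i. u i \<noteq> v i)"

definition spin :: "vertex \<Rightarrow> vertex \<Rightarrow> nat" where
  "spin u v = v (direction u v)"

fun arc_weight :: "(nat \<Rightarrow> nat \<Rightarrow> 'r) \<Rightarrow> 'r \<Rightarrow> arc \<Rightarrow> 'r" where
  "arc_weight x y (Cube u v) = x (direction u v) (spin u v)"
| "arc_weight x y (Diag u v) = y"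

section \<open>The polynomial ring\<close>

text \<open>\<open>X i \<epsilon>\<close> is used for \<open>1 \<le> i \<le> n\<close> and \<open>\<epsilon> \<in> {0, 1}\<close> only.\<close>
datatype indet = T | X nat nat | Y

type_synonym 'a mpoly = "(indet \<Rightarrow>\<^sub>0 nat) \<Rightarrow>\<^sub>0 'a"

definition Var :: "indet \<Rightarrow> 'a :: comm_ring_1 mpoly" where
  "Var z = Poly_Mapping.single (Poly_Mapping.single z 1) 1"

section \<open>Well-definedness\<close>

lemma finite_cube_verts: "finite (cube_verts n)"
  unfolding cube_verts_def by (intro finite_PiE) auto

lemma antipode_in_cube_verts: "antipode n v \<in> cube_verts n" if "v \<in> cube_verts n"
  using that unfolding cube_verts_def antipode_def by (auto simp: PiE_iff)

lemma fin_digraph_diag_cube: "fin_digraph (diag_cube n)"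
proof
  have "arcs (diag_cube n) \<subseteq>
      (\<lambda>(u, v). Cube u v) ` (cube_verts n \<times> cube_verts n) \<union>
      (\<lambda>v. Diag v (antipode n v)) ` cube_verts n"
    by (auto simp: diag_cube_def cube_adj_def)
  then show "finite (arcs (diag_cube n))"
    by (rule finite_subset) (simp add: finite_cube_verts)
qed (auto simp: diag_cube_def cube_adj_def finite_cube_verts antipode_in_cube_verts)

lemma finite_rooted_forests:
  assumes "fin_digraph D"
  shows "finite {F. rooted_forest D F}"
proof -
  interpret fin_digraph D by fact
  have "F \<in> (\<lambda>A. \<lparr>verts = verts D, arcs = A, tail = tail D, head = head D\<rparr>) ` Pow (arcs D)"
    if "rooted_forest D F" for F
  proof
    show "F = \<lparr>verts = verts D, arcs = arcs F, tail = tail D, head = head D\<rparr>"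
      using that by (simp add: rooted_forest_def spanning_def subgraph_def compatible_def)
    show "arcs F \<in> Pow (arcs D)"
      using that by (simp add: rooted_forest_def spanning_def subgraph_def)
  qed
  then have "{F. rooted_forest D F} \<subseteq>
      (\<lambda>A. \<lparr>verts = verts D, arcs = A, tail = tail D, head = head D\<rparr>) ` Pow (arcs D)"
    by blast
  then show ?thesis
    by (rule finite_subset) simp
qed

lemma direction_spin_flip:
  assumes "u i = 1 - e" "e \<in> {0, 1}"
  shows "direction u (u(i := e)) = i" "spin u (u(i := e)) = e"
proof -
  show "direction u (u(i := e)) = i"
    unfolding direction_def using assms by (intro the_equality) (auto split: if_splits)
  then show "spin u (u(i := e)) = e"
    by (simp add: spin_def)
qed

lemma cube_adj_iff_flip:
  "cube_adj n u v \<longleftrightarrow> u \<in> cube_verts n \<and> (\<exists>i \<in> {1..n}. v = u(i := 1 - u i))"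
proof
  assume adj: "cube_adj n u v"
  then obtain i where i: "{i \<in> {1..n}. u i \<noteq> v i} = {i}"
    by (auto simp: cube_adj_def card_1_singleton_iff)
  have "v j = (u(i := 1 - u i)) j" for j
  proof (cases "j \<in> {1..n}")
    case True
    then have "u j \<in> {0, 1}" "v j \<in> {0, 1}"
      using adj by (auto simp: cube_adj_def cube_verts_def PiE_iff)
    moreover have "u j \<noteq> v j \<longleftrightarrow> j = i"
      using i True by blast
    ultimately show ?thesis by auto
  next
    case False
    then have "u j = undefined" "v j = undefined"
      using adj by (auto simp: cube_adj_def cube_verts_def PiE_def extensional_def)
    moreover have "j \<noteq> i"
      using i False by blast
    ultimately have "u j = undefined" "v j = undefined" "j \<noteq> i"
      by blast+
    then show ?thesis by simp
  qed
  then show "u \<in> cube_verts n \<and> (\<exists>i \<in> {1..n}. v = u(i := 1 - u i))"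
    using adj i by (metis (no_types, lifting) cube_adj_def ext insertI1 mem_Collect_eq)
next
  assume "u \<in> cube_verts n \<and> (\<exists>i \<in> {1..n}. v = u(i := 1 - u i))"
  then obtain i where u: "u \<in> cube_verts n" and i: "i \<in> {1..n}" and v: "v = u(i := 1 - u i)"
    by blast
  have ui: "u i \<in> {0, 1}"
    using u i by (auto simp: cube_verts_def PiE_iff)
  then have "{j \<in> {1..n}. u j \<noteq> v j} = {i}"
    using v i by auto
  moreover have "v \<in> cube_verts n"
    using u i ui v by (auto simp: cube_verts_def PiE_iff extensional_def)
  ultimately show "cube_adj n u v"
    using u by (simp add: cube_adj_def)
qed

end

theory Submission
  imports Defs "Jordan_Normal_Form.Determinant"
begin

text \<open>
  By the matrix-forest theorem the enumerator is \<open>det (t I + L)\<close> with \<open>L\<close> the weighted Laplacian.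
  On functions on \<open>{0, 1}\<^sup>n\<close>, viewed as an \<open>n\<close>-fold tensor power, \<open>L\<close> is a sum of operators acting on
  one coordinate plus \<open>y (I - P)\<close>, where \<open>P\<close> flips every coordinate.  In the basis \<open>(1, 1), (0, 1)\<close>
  of each factor the coordinate operator is triangular with diagonal \<open>0, x\<^bsub>i,0\<^esub> + x\<^bsub>i,1\<^esub>\<close> and the flip
  is triangular with diagonal \<open>1, -1\<close>.  The change of basis is the zeta matrix of the
  Boolean lattice, which is unitriangular, so this works over every commutative ring, and
  the diagonal entry at \<open>S\<close> is the factor \<open>t + (1 - (-1)\<^bsup>|S|\<^esup>) y + \<Sum>\<^bsub>i \<in> S\<^esub> (x\<^bsub>i,0\<^esub> + x\<^bsub>i,1\<^esub>)\<close>.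
\<close>

section \<open>Functional digraphs\<close>

definition roots :: "('v, 'e) pre_digraph \<Rightarrow> 'v set" where
  "roots G = {v \<in> verts G. out_arcs G v = {}}"

lemma rootsI: "r \<in> verts G \<Longrightarrow> (\<And>a. a \<in> arcs G \<Longrightarrow> tail G a \<noteq> r) \<Longrightarrow> r \<in> roots G"
  by (auto simp: roots_def out_arcs_def)

lemma no_dominates_root: "r \<in> roots G \<Longrightarrow> \<not> r \<rightarrow>\<^bsub>G\<^esub> v"
  by (auto simp: roots_def out_arcs_def)

text \<open>Injectivity of \<open>tail\<close> encodes out-degree at most one without cardinalities.
  Such a digraph is the graph of a partial successor map, so a walk is determined by its start and
  its length.\<close>

locale functional_digraph = fin_digraph +
  assumes inj_on_tail: "inj_on (tail G) (arcs G)"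
begin

lemma dominates_unique: "u \<rightarrow> v \<Longrightarrow> u \<rightarrow> w \<Longrightarrow> v = w"
  using inj_on_tail by (auto simp: inj_on_def elim!: reachableE)

lemma root_reachable_eq: "r \<in> roots G \<Longrightarrow> r \<rightarrow>\<^sup>* v \<Longrightarrow> v = r"
  by (erule converse_reachable_cases) (auto dest: no_dominates_root)

text \<open>A root has no successor, so the walk from \<open>u\<close> to \<open>r\<close> is
  nonempty, and its first step can only go to \<open>v\<close>.\<close>

lemma reachable_successor:
  assumes "u \<rightarrow>\<^sup>* r" "r \<in> roots G" "u \<rightarrow> v"
  shows "v \<rightarrow>\<^sup>* r"
  using assms by (metis converse_reachable_cases dominates_unique no_dominates_root)

lemma forest_iff_no_closed_reach: "forest G \<longleftrightarrow> (\<forall>u. \<not> u \<rightarrow>\<^sup>+ u)"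
  unfolding forest_def
  by (metis closed_w_def closed_w_imp_cycle cycle_def length_greater_0_conv reachable1_awalk)

text \<open>Following arcs in a finite acyclic digraph must stop, and it stops at a root.
  Conversely, a walk that starts on a cycle of a functional digraph can never leave it, and a cycle
  contains no root.\<close>

lemma forest_iff_reachable_root:
  "forest G \<longleftrightarrow> (\<forall>v \<in> verts G. \<exists>r \<in> roots G. v \<rightarrow>\<^sup>* r)"
proof
  assume "forest G"
  then have "acyclic (arcs_ends G)"
    by (simp add: forest_iff_no_closed_reach acyclic_def)
  moreover have "finite (arcs_ends G)"
    by (simp add: arcs_ends_def)
  ultimately have "wf ((arcs_ends G)\<inverse>)"
    by (simp add: finite_acyclic_wf_converse)
  then show "\<forall>v \<in> verts G. \<exists>r \<in> roots G. v \<rightarrow>\<^sup>* r"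
  proof (intro ballI)
    fix v assume "v \<in> verts G"
    with \<open>wf ((arcs_ends G)\<inverse>)\<close> show "\<exists>r \<in> roots G. v \<rightarrow>\<^sup>* r"
    proof (induction v rule: wf_induct_rule)
      case (less v)
      show ?case
      proof (cases "v \<in> roots G")
        case False
        then obtain a where "a \<in> arcs G" "tail G a = v"
          using less.prems rootsI by metis
        then have "v \<rightarrow> head G a"
          using in_arcs_imp_in_arcs_ends by blast
        then show ?thesis
          using less.IH adj_in_verts adj_reachable_trans by blast
      qed (use less.prems in auto)
    qed
  qed
next
  assume reach: "\<forall>v \<in> verts G. \<exists>r \<in> roots G. v \<rightarrow>\<^sup>* r"
  show "forest G"
    unfolding forest_iff_no_closed_reach
  proof (intro allI notI)
    fix u assume u: "u \<rightarrow>\<^sup>+ u"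
    then obtain r where r: "r \<in> roots G" "u \<rightarrow>\<^sup>* r"
      using reach reachable1_in_verts by blast
    \<comment> \<open>Lying on a closed walk passes from \<open>x\<close> to its successor
      \<open>y\<close>: the closed walk through \<open>x\<close> has to leave \<open>x\<close>
      towards \<open>y\<close>.\<close>
    from r(2) have "r \<rightarrow>\<^sup>+ r"
    proof (induction rule: reachable_induct)
      case (step x y)
      then obtain z where "x \<rightarrow> z" "z \<rightarrow>\<^sup>* x"
        by (meson tranclD reachable_conv' adj_in_verts(2))
      then have "y \<rightarrow>\<^sup>* x"
        using dominates_unique step.hyps(2) by metis
      then show ?case
        using reachable_reachable1_trans step.hyps(2) by (meson r_into_trancl)
    qed (use u in simp)
    then show False
      using no_dominates_root r(1) by (meson tranclD)
  qed
qed

text \<open>The root that is reached does not change along an arc: against the arc the walk is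
  prolonged, along it \<open>reachable_successor\<close> applies. Hence it is constant on weakly
  connected sets.\<close>

lemma reachable_root_connected:
  assumes "(u, v) \<in> rtrancl_on A ((arcs_ends G)\<^sup>s)" "r \<in> roots G"
  shows "u \<rightarrow>\<^sup>* r \<Longrightarrow> v \<rightarrow>\<^sup>* r"
  using assms(1)
proof (induction rule: rtrancl_on_induct)
  case (step v w)
  then have "v \<rightarrow> w \<or> w \<rightarrow> v"
    by (auto simp: symcl_def)
  then show ?case
    using step adj_reachable_trans reachable_successor[OF _ assms(2)] by metis
qed simp

lemma subgraph_reaching: "subgraph (G \<restriction> {v. v \<rightarrow>\<^sup>* r}) G"
  by (intro induced_imp_subgraph induced_induce) (auto dest: reachable_in_verts)

text \<open>Every vertex on a walk to \<open>r\<close> reaches \<open>r\<close> itself, so the walk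
  stays inside the induced subgraph. After symmetrization any two vertices are joined through
  \<open>r\<close>.\<close>

lemma connected_induce_reaching:
  assumes "r \<in> verts G"
  shows "connected (G \<restriction> {v. v \<rightarrow>\<^sup>* r})"
proof -
  let ?H = "G \<restriction> {v. v \<rightarrow>\<^sup>* r}"
  interpret H: wf_digraph ?H by (rule wellformed_induce_subgraph)
  interpret S: pair_wf_digraph "mk_symmetric ?H" by (rule H.wellformed_mk_symmetric)
  have H: "v \<rightarrow>\<^sup>*\<^bsub>?H\<^esub> r" if "v \<rightarrow>\<^sup>* r" for v
    using that
  proof (induction rule: converse_reachable_induct)
    case (step x y)
    then have "x \<rightarrow>\<^bsub>?H\<^esub> y"
      using adj_reachable_trans reachable_in_verts by (auto simp: arcs_ends_conv intro!: image_eqI)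
    then show ?case
      using step.IH H.adj_reachable_trans by blast
  qed (use assms in auto)
  show ?thesis
  proof (rule H.connectedI)
    show "verts ?H \<noteq> {}"
      using assms by auto
    fix u v assume "u \<in> verts ?H" "v \<in> verts ?H"
    then have "u \<rightarrow>\<^sup>*\<^bsub>?H\<^esub> r" "v \<rightarrow>\<^sup>*\<^bsub>?H\<^esub> r"
      using H by auto
    then have "u \<rightarrow>\<^sup>*\<^bsub>mk_symmetric ?H\<^esub> r" "r \<rightarrow>\<^sup>*\<^bsub>mk_symmetric ?H\<^esub> v"
      by (auto intro: H.reachable_mk_symmetricI symmetric_reachable[OF symmetric_mk_symmetric])
    then show "u \<rightarrow>\<^sup>*\<^bsub>mk_symmetric ?H\<^esub> v"
      by (rule S.reachable_trans)
  qed
qed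

text \<open>Supplies maximality: a connected subgraph meeting the basin of \<open>r\<close> cannot
  leave that basin.\<close>

lemma connected_subgraph_reaches_root:
  assumes "subgraph H G" "connected H" "r \<in> roots G" "v \<in> verts H" "v \<rightarrow>\<^sup>* r"
  shows "subgraph H (G \<restriction> {v. v \<rightarrow>\<^sup>* r})"
proof -
  have "u \<rightarrow>\<^sup>* r" if "u \<in> verts H" for u
  proof -
    have "(v, u) \<in> rtrancl_on (verts H) ((arcs_ends H)\<^sup>s)"
      using assms(2,4) that by (auto simp: connected_conv)
    then have "(v, u) \<in> rtrancl_on (verts H) ((arcs_ends G)\<^sup>s)"
      by (rule rtrancl_on_mono[rotated 2]) (use arcs_ends_mono[OF assms(1)] in \<open>auto simp: symcl_def\<close>)
    then show ?thesis
      using reachable_root_connected assms(3,5) by blast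
  qed
  then show ?thesis
    using assms(1) wellformed_induce_subgraph
    by (auto simp: subgraph_def compatible_def wf_digraph.wellformed)
qed

text \<open>The trees are the basins of the roots: each basin is connected and absorbs every
  connected subgraph that meets it, and in a forest every vertex lies in some basin.\<close>

lemma trees_eq_image_roots:
  assumes "forest G"
  shows "trees G = (\<lambda>r. G \<restriction> {v. v \<rightarrow>\<^sup>* r}) ` roots G"
proof (intro Set.set_eqI iffI)
  fix H assume "H \<in> trees G"
  then have H: "max_subgraph connected H"
    by (simp add: trees_def)
  then have sub: "subgraph H G" and con: "connected H"
    by (auto simp: max_subgraph_def)
  from con obtain v where v: "v \<in> verts H"
    by (auto simp: connected_conv)
  then obtain r where r: "r \<in> roots G" "v \<rightarrow>\<^sup>* r"
    using assms sub forest_iff_reachable_root by (meson subgraph_imp_subverts subsetD)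
  let ?K = "G \<restriction> {v. v \<rightarrow>\<^sup>* r}"
  have "subgraph H ?K"
    using connected_subgraph_reaches_root sub con r v by blast
  moreover have "subgraph ?K G"
    by (rule subgraph_reaching)
  moreover have "connected ?K"
    using r by (intro connected_induce_reaching) (simp add: roots_def)
  ultimately have "H = ?K"
    using H unfolding max_subgraph_def by metis
  then show "H \<in> (\<lambda>r. G \<restriction> {v. v \<rightarrow>\<^sup>* r}) ` roots G"
    using r by blast
next
  fix H assume "H \<in> (\<lambda>r. G \<restriction> {v. v \<rightarrow>\<^sup>* r}) ` roots G"
  then obtain r where r: "r \<in> roots G" and H: "H = G \<restriction> {v. v \<rightarrow>\<^sup>* r}"
    by blast
  have rv: "r \<in> verts G"
    using r by (simp add: roots_def)
  have sub: "subgraph H G"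
    unfolding H
    by (rule subgraph_reaching)
  have "K = H" if K: "subgraph H K" "subgraph K G" "connected K" for K
  proof -
    have "r \<in> verts K"
      using K(1) rv by (auto simp: subgraph_def H)
    then have "subgraph K H"
      unfolding H using connected_subgraph_reaches_root K r rv by blast
    then show ?thesis
      using K(1) by (auto simp: subgraph_def compatible_def)
  qed
  then show "H \<in> trees G"
    unfolding trees_def max_subgraph_def
    using sub connected_induce_reaching[OF rv] H by blast
qed

text \<open>A root reaches only itself, so distinct roots have distinct basins. This lets the
  exponent of \<open>t\<close> be counted vertex by vertex.\<close>

lemma card_trees:
  assumes "forest G"
  shows "card (trees G) = card (roots G)"
proof -
  have "inj_on (\<lambda>r. G \<restriction> {v. v \<rightarrow>\<^sup>* r}) (roots G)"
  proof (rule inj_onI)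
    fix r s assume rs: "r \<in> roots G" "s \<in> roots G"
      and "G \<restriction> {v. v \<rightarrow>\<^sup>* r} = G \<restriction> {v. v \<rightarrow>\<^sup>* s}"
    then have "{v. v \<rightarrow>\<^sup>* r} = {v. v \<rightarrow>\<^sup>* s}"
      by (metis induce_subgraph_verts)
    moreover have "r \<rightarrow>\<^sup>* r"
      using rs by (simp add: roots_def)
    ultimately have "r \<rightarrow>\<^sup>* s"
      by blast
    then show "r = s"
      using root_reachable_eq rs by metis
  qed
  then show ?thesis
    using trees_eq_image_roots[OF assms] by (simp add: card_image)
qed

end

section \<open>Determinant of identity minus adjacency\<close>

definition functional_mat :: "('v, 'e) pre_digraph \<Rightarrow> (nat \<Rightarrow> 'v) \<Rightarrow> 'r :: comm_ring_1 mat" where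
  "functional_mat G e = mat (card (verts G)) (card (verts G))
     (\<lambda>(i, j). of_bool (i = j) - of_bool (e i \<rightarrow>\<^bsub>G\<^esub> e j))"

lemma functional_mat_carrier:
  "functional_mat G e \<in> carrier_mat (card (verts G)) (card (verts G))"
  by (simp add: functional_mat_def)

text \<open>Vanishing can thus be shown over the integers, a domain in which any nonzero kernel
  vector suffices, and then carried to every commutative ring.\<close>

lemma det_functional_mat_of_int:
  "det (functional_mat G e :: 'r :: comm_ring_1 mat) = of_int (det (functional_mat G e))"
proof -
  have "(functional_mat G e :: 'r mat) = map_mat of_int (functional_mat G e)"
    by (intro eq_matI) (auto simp: functional_mat_def)
  then show ?thesis
    by (metis of_int_hom.hom_det)
qed

context functional_digraph
begin

text \<open>In the Leibniz expansion only the identity survives, since a nonzero term for another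
  permutation would follow arcs forever. The diagonal entries are 1 because a forest has no
  loops.\<close>

lemma det_functional_mat_forest:
  assumes "forest G" and e: "bij_betw e {0..<card (verts G)} (verts G)"
  shows "det (functional_mat G e :: 'r :: comm_ring_1 mat) = 1"
proof -
  let ?N = "card (verts G)" and ?M = "functional_mat G e :: 'r mat"
  have ev: "e i \<in> verts G" if "i < ?N" for i
    using e that by (auto simp: bij_betw_def)
  have zero: "(\<Prod>i = 0..<?N. ?M $$ (i, p i)) = 0" if p: "p permutes {0..<?N}" "p \<noteq> id" for p
  proof (rule ccontr)
    assume nz: "(\<Prod>i = 0..<?N. ?M $$ (i, p i)) \<noteq> 0"
    have step: "e i \<rightarrow> e (p i)" if "i < ?N" "p i \<noteq> i" for i
    proof (rule ccontr)
      assume "\<not> e i \<rightarrow> e (p i)"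
      moreover have "p i < ?N"
        using permutes_in_image[OF p(1)] that(1) by simp
      ultimately have "?M $$ (i, p i) = 0"
        using that by (simp add: functional_mat_def)
      then show False
        using nz that(1) by (metis atLeastLessThan_iff finite_atLeastLessThan le0 prod_zero)
    qed
    obtain i where i: "i < ?N" "p i \<noteq> i"
      using p by (metis atLeastLessThan_iff eq_id_iff le0 permutes_not_in)
    then obtain r where r: "r \<in> roots G" "e i \<rightarrow>\<^sup>* r"
      using assms(1) ev forest_iff_reachable_root by blast
    from r(2) have "\<exists>j < ?N. r = e j \<and> p j \<noteq> j"
    \<comment> \<open>A moved vertex has its image under \<open>p\<close> as successor, and that
      image is moved too because \<open>p\<close> is injective. So the root \<open>r\<close> would
      be moved and would have an outgoing arc.\<close>
    proof (induction rule: reachable_induct)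
      case (step x y)
      then obtain j where j: "j < ?N" "x = e j" "p j \<noteq> j"
        by blast
      then have "y = e (p j)"
        using \<open>x \<rightarrow> y\<close> \<open>\<And>i. i < ?N \<Longrightarrow> p i \<noteq> i \<Longrightarrow> e i \<rightarrow> e (p i)\<close> dominates_unique by blast
      moreover have "p j < ?N"
        using permutes_in_image[OF p(1)] j(1) by simp
      moreover have "p (p j) \<noteq> p j"
        using permutes_inj[OF p(1)] j(3) by (auto dest: injD)
      ultimately show ?case
        by blast
    qed (use i in blast)
    then obtain j where "j < ?N" "r = e j" "p j \<noteq> j"
      by blast
    then have "r \<rightarrow> e (p j)"
      using step by blast
    then show False
      using no_dominates_root[OF r(1)] by metis
  qed
  have "det ?M = (\<Sum>p | p permutes {0..<?N}. signof p * (\<Prod>i = 0..<?N. ?M $$ (i, p i)))"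
    by (rule det_def'[OF functional_mat_carrier])
  also have "\<dots> = (\<Sum>p \<in> {id}. signof p * (\<Prod>i = 0..<?N. ?M $$ (i, p i)))"
    using zero by (intro sum.mono_neutral_right) (auto simp: finite_permutations permutes_id)
  also have "\<dots> = (\<Prod>i = 0..<?N. ?M $$ (i, i))"
    by (simp add: sign_id)
  also have "\<dots> = 1"
    using assms(1) by (intro prod.neutral) (auto simp: functional_mat_def forest_iff_no_closed_reach)
  finally show ?thesis .
qed

text \<open>The indicator of the vertices that reach no root is in the kernel.\<close>

lemma det_functional_mat_not_forest:
  assumes "\<not> forest G" and e: "bij_betw e {0..<card (verts G)} (verts G)"
  shows "det (functional_mat G e :: 'r :: comm_ring_1 mat) = 0"
proof -
  let ?N = "card (verts G)" and ?M = "functional_mat G e :: int mat"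
  define f :: "'a \<Rightarrow> int" where "f v = of_bool (\<not> (\<exists>r \<in> roots G. v \<rightarrow>\<^sup>* r))" for v
  obtain v where "v \<in> verts G" "f v = 1"
    using assms(1) forest_iff_reachable_root by (auto simp: f_def)
  moreover obtain k where "k \<in> {0..<?N}" "e k = v"
    using \<open>v \<in> verts G\<close> bij_betw_imp_surj_on[OF e] by (metis imageE)
  ultimately have k: "k < ?N" "f (e k) = 1"
    by simp_all
  have ker: "(\<Sum>j = 0..<?N. ?M $$ (i, j) * f (e j)) = 0" if i: "i < ?N" for i
  proof -
    have "(\<Sum>j = 0..<?N. ?M $$ (i, j) * f (e j)) =
        (\<Sum>j = 0..<?N. of_bool (i = j) * f (e j) - of_bool (e i \<rightarrow> e j) * f (e j))"
      using i by (intro sum.cong) (auto simp: functional_mat_def)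
    also have "\<dots> = f (e i) - (\<Sum>j = 0..<?N. of_bool (e i \<rightarrow> e j) * f (e j))"
      using i by (simp add: sum_subtractf of_bool_def if_distrib[of "\<lambda>x. x * _"] cong: if_cong)
    also have "(\<Sum>j = 0..<?N. of_bool (e i \<rightarrow> e j) * f (e j)) = (\<Sum>v \<in> verts G. of_bool (e i \<rightarrow> v) * f v)"
      by (rule sum.reindex_bij_betw[OF e])
    \<comment> \<open>At a root both sides are 0, as a root reaches itself. Elsewhere the sum
      reduces to the unique successor, which reaches the same roots.\<close>
    also have "\<dots> = f (e i)"
    proof (cases "e i \<in> roots G")
      case True
      then have "f (e i) = 0"
        by (auto simp: f_def roots_def)
      then show ?thesis
        using no_dominates_root[OF True] by simp
    next
      case False
      have "e i \<in> verts G"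
        using e i by (auto simp: bij_betw_def)
      with False obtain a where "a \<in> arcs G" "tail G a = e i"
        using rootsI by metis
      then obtain w where w: "e i \<rightarrow> w"
        by (metis in_arcs_imp_in_arcs_ends)
      then have "w \<in> verts G"
        by (rule adj_in_verts)
      have "(\<Sum>v \<in> verts G. of_bool (e i \<rightarrow> v) * f v) = (\<Sum>v \<in> verts G. if v = w then f v else 0)"
        using w dominates_unique by (intro sum.cong) auto
      also have "\<dots> = f w"
        using \<open>w \<in> verts G\<close> by simp
      also have "f w = f (e i)"
      proof -
        have "w \<rightarrow>\<^sup>* r \<longleftrightarrow> e i \<rightarrow>\<^sup>* r" if "r \<in> roots G" for r
          using adj_reachable_trans[OF w] reachable_successor[OF _ that w] by blast
        then show ?thesis
          by (simp add: f_def)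
      qed
      finally show ?thesis .
    qed
    finally show ?thesis by simp
  qed
  have carrier: "?M \<in> carrier_mat ?N ?N"
    by (rule functional_mat_carrier)
  have "?M *\<^sub>v vec ?N (\<lambda>j. f (e j)) = 0\<^sub>v ?N"
  proof (rule eq_vecI)
    fix i assume "i < dim_vec (0\<^sub>v ?N :: int vec)"
    then show "(?M *\<^sub>v vec ?N (\<lambda>j. f (e j))) $ i = 0\<^sub>v ?N $ i"
      using ker[of i] carrier by (auto simp: scalar_prod_def)
  qed (simp add: functional_mat_def)
  moreover have "vec ?N (\<lambda>j. f (e j)) \<noteq> 0\<^sub>v ?N"
    using k by (metis index_vec index_zero_vec(1) zero_neq_one)
  ultimately have "det ?M = 0"
    using det_0_iff_vec_prod_zero[OF carrier] by (metis vec_carrier)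
  then show ?thesis
    by (subst det_functional_mat_of_int) simp
qed

end

section \<open>The matrix-forest theorem\<close>

context fin_digraph
begin

text \<open>\<open>None\<close> makes the vertex a root. The extensional product is the index set
  that the distributive law produces from a product of row sums.\<close>

definition choices :: "('a \<Rightarrow> 'b option) set" where
  "choices = (\<Pi>\<^sub>E v \<in> verts G. insert None (Some ` out_arcs G v))"

definition choice_graph :: "('a \<Rightarrow> 'b option) \<Rightarrow> ('a, 'b) pre_digraph" where
  "choice_graph c =
     \<lparr>verts = verts G, arcs = {a \<in> arcs G. c (tail G a) = Some a}, tail = tail G, head = head G\<rparr>"

lemma choice_graph_simps [simp]:
  "verts (choice_graph c) = verts G"
  "arcs (choice_graph c) = {a \<in> arcs G. c (tail G a) = Some a}"
  "tail (choice_graph c) = tail G"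
  "head (choice_graph c) = head G"
  by (simp_all add: choice_graph_def)

lemma functional_digraph_choice_graph: "functional_digraph (choice_graph c)"
proof unfold_locales
  show "inj_on (tail (choice_graph c)) (arcs (choice_graph c))"
    unfolding inj_on_def choice_graph_simps by (metis (mono_tags, lifting) mem_Collect_eq option.inject)
qed auto

lemma choices_cases:
  assumes "c \<in> choices" "v \<in> verts G"
  shows "c v = None \<or> (\<exists>a \<in> arcs G. c v = Some a \<and> tail G a = v)"
proof -
  have "c v \<in> insert None (Some ` out_arcs G v)"
    using assms unfolding choices_def by (rule PiE_mem)
  then show ?thesis
    by auto
qed

lemma roots_choice_graph:
  assumes "c \<in> choices"
  shows "roots (choice_graph c) = {v \<in> verts G. c v = None}"
proof -
  have "out_arcs (choice_graph c) v = {} \<longleftrightarrow> c v = None" if "v \<in> verts G" for v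
    using choices_cases[OF assms that] by (auto simp: out_arcs_def)
  then show ?thesis
    by (auto simp: roots_def)
qed

text \<open>The roots contribute the powers of \<open>t\<close>; the other vertices correspond to
  the chosen arcs by taking tails.\<close>

lemma prod_choice_weights:
  fixes t :: "'r :: comm_semiring_1"
  assumes c: "c \<in> choices"
  shows "(\<Prod>v \<in> verts G. case_option t w (c v)) =
    t ^ card (roots (choice_graph c)) * (\<Prod>a \<in> arcs (choice_graph c). w a)"
proof -
  have split: "verts G = {v \<in> verts G. c v = None} \<union> {v \<in> verts G. c v \<noteq> None}"
    by blast
  have "(\<Prod>v \<in> verts G. case_option t w (c v)) =
      (\<Prod>v | v \<in> verts G \<and> c v = None. case_option t w (c v)) *
      (\<Prod>v | v \<in> verts G \<and> c v \<noteq> None. case_option t w (c v))"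
    by (subst split, rule prod.union_disjoint) auto
  also have "(\<Prod>v | v \<in> verts G \<and> c v = None. case_option t w (c v)) =
      t ^ card (roots (choice_graph c))"
    by (simp add: roots_choice_graph[OF c])
  also have "(\<Prod>v | v \<in> verts G \<and> c v \<noteq> None. case_option t w (c v)) =
      (\<Prod>a \<in> arcs (choice_graph c). w a)"
  proof (rule prod.reindex_bij_witness[of _ "tail G" "\<lambda>v. the (c v)"])
    fix v assume "v \<in> {v \<in> verts G. c v \<noteq> None}"
    then obtain a where "c v = Some a" "a \<in> arcs G" "tail G a = v"
      using choices_cases[OF c, of v] by auto
    then show "tail G (the (c v)) = v" "the (c v) \<in> arcs (choice_graph c)"
      "w (the (c v)) = case_option t w (c v)"
      by simp_all
  qed auto
  finally show ?thesis .
qed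

lemma rooted_forest_choice_graph:
  "rooted_forest G (choice_graph c) \<longleftrightarrow> forest (choice_graph c)"
proof -
  interpret F: functional_digraph "choice_graph c"
    by (rule functional_digraph_choice_graph)
  have "out_arcs (choice_graph c) v \<subseteq> {the (c v)}" for v
    by auto
  then have "out_degree (choice_graph c) v \<le> 1" for v
    unfolding out_degree_def by (metis card_mono finite.emptyI finite_insert is_singletonI is_singleton_altdef)
  then show ?thesis
    using F.wf_digraph wf_digraph
    by (auto simp: rooted_forest_def spanning_def subgraph_def compatible_def)
qed

lemma rooted_forest_obtain_choice:
  assumes "rooted_forest G F"
  obtains c where "c \<in> choices" "choice_graph c = F"
proof -
  from assms have F: "verts F = verts G" "arcs F \<subseteq> arcs G" "tail F = tail G" "head F = head G"
    by (auto simp: rooted_forest_def spanning_def subgraph_def compatible_def)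
  have unique: "a = b" if "a \<in> arcs F" "b \<in> arcs F" "tail G a = tail G b" for a b
  proof -
    have "card (out_arcs F (tail G a)) \<le> 1"
      using assms that F by (auto simp: rooted_forest_def out_degree_def)
    moreover have "finite (out_arcs F (tail G a))"
      using F(2) by (auto simp: out_arcs_def intro: finite_subset[OF _ finite_arcs])
    ultimately show ?thesis
      using that F(3) by (auto simp: card_le_Suc0_iff_eq)
  qed
  \<comment> \<open>\<open>None\<close> marks the roots of \<open>F\<close>; elsewhere
    \<open>SOME\<close> picks the only outgoing arc, by \<open>unique\<close>.\<close>
  define c where "c = (\<lambda>v \<in> verts G.
    if out_arcs F v = {} then None else Some (SOME a. a \<in> out_arcs F v))"
  have some: "(SOME a. a \<in> out_arcs F v) \<in> out_arcs F v" if "out_arcs F v \<noteq> {}" for v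
    using that by (simp only: some_in_eq not_False_eq_True)
  show thesis
  proof
    show "c \<in> choices"
      using some F by (fastforce simp: c_def choices_def)
    have "c (tail G a) = Some a \<longleftrightarrow> a \<in> arcs F" if "a \<in> arcs G" for a
    proof (cases "out_arcs F (tail G a) = {}")
      case True
      moreover have "a \<in> arcs F \<Longrightarrow> a \<in> out_arcs F (tail G a)"
        using F by simp
      ultimately show ?thesis
        using that by (auto simp: c_def)
    next
      case False
      define b where "b = (SOME b. b \<in> out_arcs F (tail G a))"
      have "b \<in> arcs F" "tail G b = tail G a"
        using some[OF False] F by (simp_all add: b_def)
      moreover have "c (tail G a) = Some b"
        using False that by (simp add: c_def b_def)
      ultimately show ?thesis
        using unique by auto
    qed
    then show "choice_graph c = F"
      using F by (intro pre_digraph.equality) auto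
  qed
qed

text \<open>Arcs determine the choice at each vertex, and off the vertex set both functions are
  \<open>undefined\<close>.\<close>

lemma inj_on_choice_graph: "inj_on choice_graph choices"
proof (rule inj_onI)
  fix c d assume cd: "c \<in> choices" "d \<in> choices" and eq: "choice_graph c = choice_graph d"
  have "arcs (choice_graph c) = arcs (choice_graph d)"
    using eq by simp
  then have arcs: "c (tail G a) = Some a \<longleftrightarrow> d (tail G a) = Some a" if "a \<in> arcs G" for a
    using that unfolding choice_graph_simps by blast
  show "c = d"
  proof
    fix v
    show "c v = d v"
    proof (cases "v \<in> verts G")
      case True
      show ?thesis
        using choices_cases[OF cd(1) True] choices_cases[OF cd(2) True] arcs by metis
    next
      case False
      then show ?thesis
        using cd by (auto simp: choices_def PiE_def extensional_def)
    qed
  qed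
qed

text \<open>Rooted forests correspond to acyclic choices. The indicator stays a factor so that it
  can be matched with a determinant equal to 1 or 0.\<close>

lemma forest_enumerator_choices:
  "forest_enumerator G w t =
    (\<Sum>c \<in> choices. (\<Prod>v \<in> verts G. case_option t w (c v)) * of_bool (forest (choice_graph c)))"
proof -
  have fin: "finite choices"
    unfolding choices_def by (intro finite_PiE) auto
  have img: "{F. rooted_forest G F} = choice_graph ` {c \<in> choices. forest (choice_graph c)}"
  proof (intro Set.set_eqI iffI)
    fix F assume "F \<in> {F. rooted_forest G F}"
    then have "rooted_forest G F"
      by simp
    then obtain c where "c \<in> choices" "choice_graph c = F"
      by (rule rooted_forest_obtain_choice)
    with \<open>rooted_forest G F\<close> show "F \<in> choice_graph ` {c \<in> choices. forest (choice_graph c)}"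
      using rooted_forest_choice_graph by blast
  qed (use rooted_forest_choice_graph in blast)
  have "forest_enumerator G w t = (\<Sum>c | c \<in> choices \<and> forest (choice_graph c).
      t ^ card (trees (choice_graph c)) * (\<Prod>a \<in> arcs (choice_graph c). w a))"
    unfolding forest_enumerator_def img
    by (subst sum.reindex) (auto intro: inj_on_subset[OF inj_on_choice_graph])
  also have "\<dots> = (\<Sum>c | c \<in> choices \<and> forest (choice_graph c).
      \<Prod>v \<in> verts G. case_option t w (c v))"
    using functional_digraph.card_trees[OF functional_digraph_choice_graph]
    by (intro sum.cong refl) (simp add: prod_choice_weights del: choice_graph_simps)
  also have "\<dots> = (\<Sum>c \<in> choices.
      (\<Prod>v \<in> verts G. case_option t w (c v)) * of_bool (forest (choice_graph c)))"
    using fin by (simp add: sum.inter_filter of_bool_def if_distrib cong: if_cong)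
  finally show ?thesis .
qed

text \<open>This is \<open>t\<close> times the identity plus the weighted out-degree Laplacian.
  Parallel arcs add up, and a loop cancels itself.\<close>

definition forest_mat :: "('b \<Rightarrow> 'r) \<Rightarrow> 'r \<Rightarrow> (nat \<Rightarrow> 'a) \<Rightarrow> 'r :: comm_ring_1 mat" where
  "forest_mat w t e = mat (card (verts G)) (card (verts G))
     (\<lambda>(i, j). of_bool (i = j) * t
        + (\<Sum>a \<in> out_arcs G (e i). w a * (of_bool (i = j) - of_bool (head G a = e j))))"

lemma forest_mat_carrier: "forest_mat w t e \<in> carrier_mat (card (verts G)) (card (verts G))"
  by (simp add: forest_mat_def)

text \<open>Reads the matrix as an operator on functions on the vertices, so that its product with
  another matrix can be computed column by column without naming entries.\<close>

lemma forest_mat_apply: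
  assumes e: "bij_betw e {0..<card (verts G)} (verts G)" and i: "i < card (verts G)"
  shows "(\<Sum>j = 0..<card (verts G). forest_mat w t e $$ (i, j) * f (e j)) =
    t * f (e i) + (\<Sum>a \<in> out_arcs G (e i). w a * (f (e i) - f (head G a)))"
proof -
  let ?N = "card (verts G)"
  have delta: "(\<Sum>j = 0..<?N. of_bool (i = j) * f (e j)) = f (e i)"
    using i by (simp add: of_bool_def if_distrib[of "\<lambda>x. x * _"] cong: if_cong)
  have head: "(\<Sum>j = 0..<?N. of_bool (head G a = e j) * f (e j)) = f (head G a)"
    if "a \<in> out_arcs G (e i)" for a
  proof -
    have "(\<Sum>j = 0..<?N. of_bool (head G a = e j) * f (e j)) =
        (\<Sum>v \<in> verts G. of_bool (head G a = v) * f v)"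
      by (rule sum.reindex_bij_betw[OF e])
    also have "\<dots> = f (head G a)"
      using that by (simp add: of_bool_def if_distrib[of "\<lambda>x. x * _"] cong: if_cong)
    finally show ?thesis .
  qed
  have "(\<Sum>j = 0..<?N. forest_mat w t e $$ (i, j) * f (e j)) =
      (\<Sum>j = 0..<?N. t * (of_bool (i = j) * f (e j)) + (\<Sum>a \<in> out_arcs G (e i).
        w a * (of_bool (i = j) * f (e j) - of_bool (head G a = e j) * f (e j))))"
    using i by (intro sum.cong refl)
      (simp add: forest_mat_def distrib_right sum_distrib_right left_diff_distrib mult.assoc mult.left_commute)
  also have "\<dots> = t * (\<Sum>j = 0..<?N. of_bool (i = j) * f (e j)) + (\<Sum>a \<in> out_arcs G (e i). w a *
      ((\<Sum>j = 0..<?N. of_bool (i = j) * f (e j)) - (\<Sum>j = 0..<?N. of_bool (head G a = e j) * f (e j))))"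
    by (simp only: sum.distrib sum_distrib_left right_diff_distrib sum_subtractf
        sum.swap[where A = "{0..<?N}" and B = "out_arcs G (e i)"])
  also have "\<dots> = t * f (e i) + (\<Sum>a \<in> out_arcs G (e i). w a * (f (e i) - f (head G a)))"
    unfolding delta by (intro arg_cong2[where f = "(+)"] sum.cong refl) (simp only: head)
  finally show ?thesis .
qed

text \<open>
  The determinant is expanded multilinearly in the rows; each choice of one summand per row is a
  functional digraph.
\<close>

theorem matrix_forest:
  fixes t :: "'r :: comm_ring_1"
  assumes e: "bij_betw e {0..<card (verts G)} (verts G)"
  shows "det (forest_mat w t e) = forest_enumerator G w t"
proof -
  let ?N = "card (verts G)"
  \<comment> \<open>The part of row \<open>i\<close> belonging to one outcome at \<open>e i\<close>,
    without its weight: a unit row for \<open>None\<close>, the Laplacian row of a single arc for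
    \<open>Some a\<close>.\<close>
  define h :: "'b option \<Rightarrow> nat \<Rightarrow> nat \<Rightarrow> 'r" where "h o' i j = of_bool (i = j) -
    (case o' of None \<Rightarrow> 0 | Some a \<Rightarrow> of_bool (head G a = e j))" for o' i j
  have ev: "e i \<in> verts G" if "i < ?N" for i
    using e that by (auto simp: bij_betw_def)
  have inj: "e i = e j \<longleftrightarrow> i = j" if "i < ?N" "j < ?N" for i j
    using e that by (auto simp: bij_betw_def inj_on_def)
  have entry: "forest_mat w t e $$ (i, j) =
      (\<Sum>o' \<in> insert None (Some ` out_arcs G (e i)). case_option t w o' * h o' i j)"
    if "i < ?N" "j < ?N" for i j
    using that finite_out_arcs
    by (subst sum.insert) (auto simp: forest_mat_def h_def sum.reindex algebra_simps)
  have choice_entry: "functional_mat (choice_graph c) e $$ (i, j) = h (c (e i)) i j"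
    if c: "c \<in> choices" and ij: "i < ?N" "j < ?N" for c i j
  proof -
    have "e i \<rightarrow>\<^bsub>choice_graph c\<^esub> e j \<longleftrightarrow> (\<exists>a \<in> arcs G. tail G a = e i \<and> c (e i) = Some a \<and> head G a = e j)"
      by (auto simp: arcs_ends_conv image_iff)
    then show ?thesis
      using choices_cases[OF c ev[OF ij(1)]] ij by (auto simp: functional_mat_def h_def)
  qed
  have expand: "(\<Prod>i = 0..<?N. forest_mat w t e $$ (i, p i)) =
      (\<Sum>c \<in> choices. (\<Prod>v \<in> verts G. case_option t w (c v)) *
        (\<Prod>i = 0..<?N. functional_mat (choice_graph c) e $$ (i, p i)))"
    if p: "p permutes {0..<?N}" for p
  proof -
    have pi: "p i < ?N" if "i < ?N" for i
      using permutes_in_image[OF p] that by simp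
    \<comment> \<open>The inverse of \<open>e\<close> turns factors indexed by positions into
      factors indexed by vertices, over which \<open>choices\<close> is a product set.\<close>
    define d where "d = inv_into {0..<?N} e"
    have d: "d (e i) = i" if "i < ?N" for i
      using e that by (simp add: d_def bij_betw_def)
    define g where "g v o' = case_option t w o' * h o' (d v) (p (d v))" for v o'
    have "(\<Prod>i = 0..<?N. forest_mat w t e $$ (i, p i)) =
        (\<Prod>i = 0..<?N. \<Sum>o' \<in> insert None (Some ` out_arcs G (e i)). g (e i) o')"
      using d pi by (intro prod.cong refl) (simp add: entry g_def)
    also have "\<dots> = (\<Prod>v \<in> verts G. \<Sum>o' \<in> insert None (Some ` out_arcs G v). g v o')"
      by (rule prod.reindex_bij_betw[OF e])
    also have "\<dots> = (\<Sum>c \<in> choices. \<Prod>v \<in> verts G. g v (c v))"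
      unfolding choices_def by (rule prod_sum_PiE) auto
    also have "\<dots> = (\<Sum>c \<in> choices. (\<Prod>v \<in> verts G. case_option t w (c v)) *
        (\<Prod>i = 0..<?N. functional_mat (choice_graph c) e $$ (i, p i)))"
    proof (rule sum.cong[OF refl])
      fix c assume c: "c \<in> choices"
      have "(\<Prod>v \<in> verts G. h (c v) (d v) (p (d v))) =
          (\<Prod>i = 0..<?N. h (c (e i)) (d (e i)) (p (d (e i))))"
        by (rule prod.reindex_bij_betw[OF e, symmetric])
      also have "\<dots> = (\<Prod>i = 0..<?N. functional_mat (choice_graph c) e $$ (i, p i))"
        using c d pi by (intro prod.cong refl) (simp add: choice_entry)
      finally show "(\<Prod>v \<in> verts G. g v (c v)) = (\<Prod>v \<in> verts G. case_option t w (c v)) *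
          (\<Prod>i = 0..<?N. functional_mat (choice_graph c) e $$ (i, p i))"
        by (simp add: g_def prod.distrib)
    qed
    finally show ?thesis .
  qed
  \<comment> \<open>The Leibniz formula is applied with each product of rows expanded; after the
    sums are swapped it is read backwards for each choice.\<close>
  have "det (forest_mat w t e) = (\<Sum>p | p permutes {0..<?N}. \<Sum>c \<in> choices.
      signof p * ((\<Prod>v \<in> verts G. case_option t w (c v)) *
        (\<Prod>i = 0..<?N. functional_mat (choice_graph c) e $$ (i, p i))))"
    unfolding det_def'[OF forest_mat_carrier] by (intro sum.cong refl) (simp add: expand sum_distrib_left)
  also have "\<dots> = (\<Sum>c \<in> choices. \<Sum>p | p permutes {0..<?N}.
      signof p * ((\<Prod>v \<in> verts G. case_option t w (c v)) *
        (\<Prod>i = 0..<?N. functional_mat (choice_graph c) e $$ (i, p i))))"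
    by (rule sum.swap)
  also have "\<dots> = (\<Sum>c \<in> choices. (\<Prod>v \<in> verts G. case_option t w (c v)) *
      det (functional_mat (choice_graph c) e))"
  proof (intro sum.cong refl)
    fix c
    have "det (functional_mat (choice_graph c) e :: 'r mat) = (\<Sum>p | p permutes {0..<?N}.
        signof p * (\<Prod>i = 0..<?N. functional_mat (choice_graph c) e $$ (i, p i)))"
      using det_def'[OF functional_mat_carrier, of "choice_graph c" e] by simp
    then show "(\<Sum>p | p permutes {0..<?N}. signof p * ((\<Prod>v \<in> verts G. case_option t w (c v)) *
        (\<Prod>i = 0..<?N. functional_mat (choice_graph c) e $$ (i, p i)))) =
        (\<Prod>v \<in> verts G. case_option t w (c v)) * det (functional_mat (choice_graph c) e)"
      by (simp add: sum_distrib_left mult.left_commute)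
  qed
  also have "\<dots> = forest_enumerator G w t"
    unfolding forest_enumerator_choices
  proof (intro sum.cong refl arg_cong2[where f = "(*)"])
    fix c
    interpret F: functional_digraph "choice_graph c"
      by (rule functional_digraph_choice_graph)
    show "det (functional_mat (choice_graph c) e) = of_bool (forest (choice_graph c))"
      using F.det_functional_mat_forest[of e] F.det_functional_mat_not_forest[of e] e by auto
  qed
  finally show ?thesis .
qed

end

section \<open>Forests of the cube with diagonals\<close>

lemma sum_Pow_alternating:
  assumes "finite A"
  shows "(\<Sum>Q \<in> Pow A. (-1) ^ card Q) = (of_bool (A = {}) :: 'r :: comm_ring_1)"
  using assms
proof (induction A rule: finite_induct)
  case (insert a A)
  have "(\<Sum>Q \<in> insert a ` Pow A. (-1) ^ card Q) = (\<Sum>Q \<in> Pow A. (-1 :: 'r) ^ card (insert a Q))"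
    using insert.hyps(2) by (intro sum.reindex_cong[of "insert a"]) (auto simp: inj_on_def)
  \<comment> \<open>Adding \<open>a\<close> to a subset of \<open>A\<close> raises its size by one
    and so reverses the sign; the two halves of the power set cancel.\<close>
  also have "\<dots> = - (\<Sum>Q \<in> Pow A. (-1) ^ card Q)"
    using insert.hyps by (simp add: sum_negf[symmetric])
      (intro sum.cong refl, metis Pow_iff card_insert_disjoint finite_subset mult_minus1 power_Suc subsetD)
  finally have shifted: "(\<Sum>Q \<in> insert a ` Pow A. (-1) ^ card Q) = - (\<Sum>Q \<in> Pow A. (-1 :: 'r) ^ card Q)" .
  have "(\<Sum>Q \<in> Pow (insert a A). (-1 :: 'r) ^ card Q) =
      (\<Sum>Q \<in> Pow A. (-1) ^ card Q) + (\<Sum>Q \<in> insert a ` Pow A. (-1) ^ card Q)"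
    unfolding Pow_insert using insert.hyps by (intro sum.union_disjoint) auto
  then show ?case
    by (simp add: shifted)
qed simp

text \<open>Sets are listed by increasing binary code \<open>set_encode\<close>, which is monotone
  under inclusion. In this order matrices supported on inclusions are triangular.\<close>

lemma linear_extension_of_subsets:
  fixes \<F> :: "nat set set"
  assumes "finite \<F>" "\<And>A. A \<in> \<F> \<Longrightarrow> finite A"
  obtains s where "bij_betw s {0..<card \<F>} \<F>"
    "\<forall>i < card \<F>. \<forall>j < card \<F>. s i \<subseteq> s j \<longrightarrow> i \<le> j"
proof -
  define xs where "xs = sorted_list_of_set (set_encode ` \<F>)"
  have inj: "inj_on set_encode \<F>"
    using assms(2) by (intro inj_on_subset[OF inj_on_set_encode]) auto
  have len: "length xs = card \<F>"
    using inj by (simp add: xs_def card_image)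
  have bij: "bij_betw ((!) xs) {0..<card \<F>} (set_encode ` \<F>)"
  proof (rule bij_betw_nth)
    show "distinct xs" "set_encode ` \<F> = set xs"
      using assms(1) by (simp_all add: xs_def)
    show "{0..<card \<F>} = {..<length xs}"
      unfolding len by (rule atLeast0LessThan)
  qed
  have dec: "bij_betw set_decode (set_encode ` \<F>) \<F>"
    by (rule bij_betw_byWitness[where f' = set_encode]) (auto simp: assms(2))
  show thesis
  proof
    show "bij_betw (set_decode \<circ> (!) xs) {0..<card \<F>} \<F>"
      using bij dec by (rule bij_betw_trans)
    have "i \<le> j" if ij: "i < card \<F>" "j < card \<F>"
      "(set_decode \<circ> (!) xs) i \<subseteq> (set_decode \<circ> (!) xs) j" for i j
    proof -
      have "xs ! i \<le> xs ! j"
        using ij(3) by (simp add: subset_decode_imp_le)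
      moreover have "xs ! j < xs ! i" if "j < i"
        using that ij(1) len strict_sorted_list_of_set[of "set_encode ` \<F>"]
        unfolding xs_def[symmetric] by (simp add: sorted_wrt_nth_less)
      ultimately show ?thesis
        by (meson leD leI)
    qed
    then show "\<forall>i < card \<F>. \<forall>j < card \<F>.
        (set_decode \<circ> (!) xs) i \<subseteq> (set_decode \<circ> (!) xs) j \<longrightarrow> i \<le> j"
      by blast
  qed
qed

lemma det_mat_upper_triangular:
  assumes "\<And>i j. i < n \<Longrightarrow> j < i \<Longrightarrow> f i j = 0"
  shows "det (mat n n (\<lambda>(i, j). f i j)) = (\<Prod>i = 0..<n. f i i)"
proof -
  have "upper_triangular (mat n n (\<lambda>(i, j). f i j))"
    using assms by auto
  then have "det (mat n n (\<lambda>(i, j). f i j)) = prod_list (diag_mat (mat n n (\<lambda>(i, j). f i j)))"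
    by (rule det_upper_triangular[of _ n]) simp
  also have "\<dots> = (\<Prod>i = 0..<n. f i i)"
    by (auto simp: prod_list_diag_prod)
  finally show ?thesis .
qed

section \<open>Subsets as vertices of the cube\<close>

definition indicator_vertex :: "nat \<Rightarrow> nat set \<Rightarrow> vertex" where
  "indicator_vertex n S = (\<lambda>i \<in> {1..n}. of_bool (i \<in> S))"

lemma bij_betw_indicator_vertex: "bij_betw (indicator_vertex n) (Pow {1..n}) (cube_verts n)"
proof (rule bij_betw_byWitness[where f' = "\<lambda>v. {i \<in> {1..n}. v i = 1}"])
  show "\<forall>v \<in> cube_verts n. indicator_vertex n {i \<in> {1..n}. v i = 1} = v"
  proof
    fix v assume v: "v \<in> cube_verts n"
    show "indicator_vertex n {i \<in> {1..n}. v i = 1} = v"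
    proof
      fix i
      show "indicator_vertex n {i \<in> {1..n}. v i = 1} i = v i"
        using v by (cases "i \<in> {1..n}") (auto simp: indicator_vertex_def cube_verts_def PiE_iff extensional_def)
    qed
  qed
qed (auto simp: indicator_vertex_def cube_verts_def)

lemma indicator_vertex_in_cube_verts: "indicator_vertex n S \<in> cube_verts n"
  by (auto simp: indicator_vertex_def cube_verts_def)

lemma antipode_indicator_vertex: "antipode n (indicator_vertex n S) = indicator_vertex n ({1..n} - S)"
  by (rule ext) (auto simp: antipode_def indicator_vertex_def)

lemma flip_indicator_vertex:
  assumes "i \<in> {1..n}"
  shows "(indicator_vertex n S)(i := 1 - indicator_vertex n S i) = indicator_vertex n (sym_diff S {i})"
  using assms by (intro ext) (auto simp: indicator_vertex_def)

lemma out_arcs_diag_cube: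
  "out_arcs (diag_cube n) (indicator_vertex n S) =
    insert (Diag (indicator_vertex n S) (indicator_vertex n ({1..n} - S)))
      ((\<lambda>i. Cube (indicator_vertex n S) (indicator_vertex n (sym_diff S {i}))) ` {1..n})"
proof -
  have "cube_adj n (indicator_vertex n S) v \<longleftrightarrow>
      (\<exists>i \<in> {1..n}. v = indicator_vertex n (sym_diff S {i}))" for v
    unfolding cube_adj_iff_flip using indicator_vertex_in_cube_verts flip_indicator_vertex
    by (metis (no_types, lifting))
  then show ?thesis
    by (auto simp: diag_cube_def out_arcs_def antipode_indicator_vertex
        indicator_vertex_in_cube_verts simp del: One_nat_def)
qed

text \<open>The spin is the value of the coordinate after the flip: 1 if \<open>i\<close> enters the
  set, 0 if it leaves.\<close>

lemma arc_weight_flip: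
  assumes "i \<in> {1..n}"
  shows "arc_weight x y (Cube (indicator_vertex n S) (indicator_vertex n (sym_diff S {i}))) =
    x i (of_bool (i \<notin> S))"
proof -
  have "indicator_vertex n S i = 1 - of_bool (i \<notin> S)"
    using assms by (simp add: indicator_vertex_def)
  moreover have "indicator_vertex n (sym_diff S {i}) = (indicator_vertex n S)(i := of_bool (i \<notin> S))"
  proof -
    have "of_bool (i \<notin> S) = 1 - indicator_vertex n S i"
      using assms by (simp add: indicator_vertex_def)
    then show ?thesis
      by (simp only: flip_indicator_vertex[OF assms])
  qed
  ultimately show ?thesis
    using direction_spin_flip[of "indicator_vertex n S" i "of_bool (i \<notin> S)"] by simp
qed

text \<open>No arc is counted twice: different coordinates give different heads, and the
  constructors separate the diagonal arc from the cube arcs even for \<open>n = 1\<close>.\<close>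

lemma sum_out_arcs_diag_cube:
  fixes f :: "arc \<Rightarrow> 'r :: comm_ring_1"
  shows "(\<Sum>a \<in> out_arcs (diag_cube n) (indicator_vertex n S). f a) =
    (\<Sum>i = 1..n. f (Cube (indicator_vertex n S) (indicator_vertex n (sym_diff S {i})))) +
    f (Diag (indicator_vertex n S) (indicator_vertex n ({1..n} - S)))"
proof -
  have "inj_on (\<lambda>i. Cube (indicator_vertex n S) (indicator_vertex n (sym_diff S {i}))) {1..n}"
  proof (rule inj_onI)
    fix i j assume ij: "i \<in> {1..n}" "j \<in> {1..n}"
      and "Cube (indicator_vertex n S) (indicator_vertex n (sym_diff S {i})) =
        Cube (indicator_vertex n S) (indicator_vertex n (sym_diff S {j}))"
    then have "indicator_vertex n (sym_diff S {i}) i = indicator_vertex n (sym_diff S {j}) i"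
      by simp
    then have "i \<in> sym_diff S {i} \<longleftrightarrow> i \<in> sym_diff S {j}"
      unfolding indicator_vertex_def restrict_apply'[OF ij(1)] of_bool_eq_iff .
    then show "i = j"
      by auto
  qed
  then show ?thesis
    unfolding out_arcs_diag_cube by (subst sum.insert) (auto simp: sum.reindex add.commute)
qed

text \<open>
  The coefficients of the forest matrix of the cube in the basis \<open>\<lambda>v. of_bool (\<forall>i \<in> R. v i = 1)\<close>,
  indexed by \<open>R \<subseteq> {1..n}\<close>.
\<close>

definition zeta_conjugate ::
    "(nat \<Rightarrow> nat \<Rightarrow> 'r) \<Rightarrow> 'r \<Rightarrow> 'r \<Rightarrow> nat set \<Rightarrow> nat set \<Rightarrow> 'r :: comm_ring_1" where
  "zeta_conjugate x y t Q R =
     of_bool (Q = R) * (t + y + (\<Sum>i \<in> R. x i 0 + x i 1))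
     - (\<Sum>i \<in> R. of_bool (Q = R - {i}) * x i 1)
     - y * of_bool (Q \<subseteq> R) * (-1) ^ card Q"

text \<open>This is the entry at \<open>S\<close>, \<open>R\<close> of the intertwining relation
  between the forest operator and its conjugate. The right side is the operator applied at
  \<open>S\<close> to the indicator of the sets containing \<open>R\<close>.\<close>

lemma sum_zeta_conjugate:
  fixes x :: "nat \<Rightarrow> nat \<Rightarrow> 'r :: comm_ring_1"
  assumes "S \<subseteq> {1..n}" "R \<subseteq> {1..n}"
  shows "(\<Sum>Q \<in> Pow {1..n}. of_bool (Q \<subseteq> S) * zeta_conjugate x y t Q R) =
    t * of_bool (R \<subseteq> S)
    + (\<Sum>i = 1..n. x i (of_bool (i \<notin> S)) * (of_bool (R \<subseteq> S) - of_bool (R \<subseteq> sym_diff S {i})))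
    + y * (of_bool (R \<subseteq> S) - of_bool (R \<subseteq> {1..n} - S))"
proof -
  have fin: "finite R" "finite S"
    using assms finite_subset by blast+
  have delta: "(\<Sum>Q \<in> Pow {1..n}. of_bool (Q \<subseteq> S) * (of_bool (Q = P) * c)) = of_bool (P \<subseteq> S) * c"
    if "P \<subseteq> {1..n}" for P and c :: 'r
  proof -
    have "(\<Sum>Q \<in> Pow {1..n}. of_bool (Q \<subseteq> S) * (of_bool (Q = P) * c)) =
        (\<Sum>Q \<in> Pow {1..n}. if Q = P then of_bool (P \<subseteq> S) * c else 0)"
      by (intro sum.cong) auto
    also have "\<dots> = of_bool (P \<subseteq> S) * c"
      using that by simp
    finally show ?thesis .
  qed
  have "(\<Sum>Q \<in> Pow {1..n}. of_bool (Q \<subseteq> S) * (y * of_bool (Q \<subseteq> R) * (-1) ^ card Q)) =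
      y * (\<Sum>Q \<in> Pow {1..n}. if Q \<in> Pow (R \<inter> S) then (-1) ^ card Q else 0)"
    unfolding sum_distrib_left by (intro sum.cong) auto
  also have "\<dots> = y * (\<Sum>Q \<in> Pow {1..n} \<inter> Pow (R \<inter> S). (-1) ^ card Q)"
    by (subst sum.inter_restrict) simp_all
  also have "Pow {1..n} \<inter> Pow (R \<inter> S) = Pow (R \<inter> S)"
    using assms by blast
  also have "(\<Sum>Q \<in> Pow (R \<inter> S). (-1 :: 'r) ^ card Q) = of_bool (R \<inter> S = {})"
    using fin by (intro sum_Pow_alternating) simp
  \<comment> \<open>Inclusion-exclusion detects disjointness from \<open>S\<close>, which is
    containment in the antipodal set; thus the signs produce the diagonal arc.\<close>
  also have "R \<inter> S = {} \<longleftrightarrow> R \<subseteq> {1..n} - S"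
    using assms by blast
  finally have diag: "(\<Sum>Q \<in> Pow {1..n}. of_bool (Q \<subseteq> S) * (y * of_bool (Q \<subseteq> R) * (-1) ^ card Q)) =
      y * of_bool (R \<subseteq> {1..n} - S)" .
  have "(\<Sum>Q \<in> Pow {1..n}. of_bool (Q \<subseteq> S) * (\<Sum>i \<in> R. of_bool (Q = R - {i}) * x i 1)) =
      (\<Sum>i \<in> R. \<Sum>Q \<in> Pow {1..n}. of_bool (Q \<subseteq> S) * (of_bool (Q = R - {i}) * x i 1))"
    unfolding sum_distrib_left by (rule sum.swap)
  also have "\<dots> = (\<Sum>i \<in> R. of_bool (R - {i} \<subseteq> S) * x i 1)"
    using assms by (intro sum.cong refl delta) auto
  finally have cube: "(\<Sum>Q \<in> Pow {1..n}. of_bool (Q \<subseteq> S) * (\<Sum>i \<in> R. of_bool (Q = R - {i}) * x i 1)) =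
      (\<Sum>i \<in> R. of_bool (R - {i} \<subseteq> S) * x i 1)" .
  have "(\<Sum>i = 1..n. x i (of_bool (i \<notin> S)) * (of_bool (R \<subseteq> S) - of_bool (R \<subseteq> sym_diff S {i}))) =
      (\<Sum>i \<in> R. x i (of_bool (i \<notin> S)) * (of_bool (R \<subseteq> S) - of_bool (R \<subseteq> sym_diff S {i})))"
  \<comment> \<open>Flipping a coordinate outside \<open>R\<close> does not affect whether
    \<open>R\<close> is contained.\<close>
  proof (intro sum.mono_neutral_right ballI)
    fix i assume "i \<in> {1..n} - R"
    then have "R \<subseteq> S \<longleftrightarrow> R \<subseteq> sym_diff S {i}"
      by auto
    then show "x i (of_bool (i \<notin> S)) * (of_bool (R \<subseteq> S) - of_bool (R \<subseteq> sym_diff S {i})) = 0"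
      by simp
  qed (use assms in auto)
  also have "\<dots> = (\<Sum>i \<in> R. of_bool (R \<subseteq> S) * (x i 0 + x i 1) - of_bool (R - {i} \<subseteq> S) * x i 1)"
  proof (intro sum.cong refl)
    fix i assume i: "i \<in> R"
    show "x i (of_bool (i \<notin> S)) * (of_bool (R \<subseteq> S) - of_bool (R \<subseteq> sym_diff S {i})) =
        of_bool (R \<subseteq> S) * (x i 0 + x i 1) - of_bool (R - {i} \<subseteq> S) * x i 1"
    \<comment> \<open>If \<open>i\<close> lies in \<open>S\<close>, the flip destroys containment of
      \<open>R\<close> and has weight \<open>x i 0\<close>; the two terms with \<open>x i 1\<close>
      cancel. Otherwise \<open>R\<close> is not contained in \<open>S\<close>, and the flip, of
      weight \<open>x i 1\<close>, can only create containment.\<close>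
    proof (cases "i \<in> S")
      case True
      then have "\<not> R \<subseteq> sym_diff S {i}" "R - {i} \<subseteq> S \<longleftrightarrow> R \<subseteq> S"
        using i by auto
      then show ?thesis
        using True by (simp add: algebra_simps)
    next
      case False
      then have "\<not> R \<subseteq> S" "R - {i} \<subseteq> S \<longleftrightarrow> R \<subseteq> sym_diff S {i}"
        using i by auto
      then show ?thesis
        using False by (simp add: algebra_simps)
    qed
  qed
  also have "\<dots> = of_bool (R \<subseteq> S) * (\<Sum>i \<in> R. x i 0 + x i 1) - (\<Sum>i \<in> R. of_bool (R - {i} \<subseteq> S) * x i 1)"
    by (simp add: sum_subtractf sum_distrib_left)
  finally have rhs: "(\<Sum>i = 1..n. x i (of_bool (i \<notin> S)) * (of_bool (R \<subseteq> S) - of_bool (R \<subseteq> sym_diff S {i}))) =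
      of_bool (R \<subseteq> S) * (\<Sum>i \<in> R. x i 0 + x i 1) - (\<Sum>i \<in> R. of_bool (R - {i} \<subseteq> S) * x i 1)" .
  have "(\<Sum>Q \<in> Pow {1..n}. of_bool (Q \<subseteq> S) * zeta_conjugate x y t Q R) =
      of_bool (R \<subseteq> S) * (t + y + (\<Sum>i \<in> R. x i 0 + x i 1))
      - (\<Sum>i \<in> R. of_bool (R - {i} \<subseteq> S) * x i 1) - y * of_bool (R \<subseteq> {1..n} - S)"
    unfolding zeta_conjugate_def right_diff_distrib sum_subtractf cube diag
    by (simp only: delta[OF assms(2)])
  then show ?thesis
    unfolding rhs by (simp add: algebra_simps)
qed

text \<open>The relation \<open>M * Z = Z * U\<close> with \<open>det Z = 1\<close> gives equal
  determinants of \<open>M\<close> and \<open>U\<close> without inverting \<open>Z\<close>.\<close>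

lemma forest_enumerator_diag_cube:
  fixes x :: "nat \<Rightarrow> nat \<Rightarrow> 'r :: comm_ring_1"
  shows "forest_enumerator (diag_cube n) (arc_weight x y) t =
    (\<Prod>S \<in> Pow {1..n}. t + 2 * y * of_bool (odd (card S)) + (\<Sum>i \<in> S. x i 0 + x i 1))"
proof -
  interpret D: fin_digraph "diag_cube n"
    by (rule fin_digraph_diag_cube)
  define N where "N = card (Pow {1..n})"
  have fin: "finite (Pow {1..n})" "A \<in> Pow {1..n} \<Longrightarrow> finite A" for A
    using finite_subset by auto
  obtain s where s: "bij_betw s {0..<N} (Pow {1..n})"
    and mono: "\<forall>i < N. \<forall>j < N. s i \<subseteq> s j \<longrightarrow> i \<le> j"
    unfolding N_def by (rule linear_extension_of_subsets[OF fin])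
  have not_subset: "\<not> s i \<subseteq> s j" if "i < N" "j < i" for i j
  proof
    assume "s i \<subseteq> s j"
    then have "i \<le> j"
      using mono that by simp
    then show False
      using that by simp
  qed
  have sub: "s i \<subseteq> {1..n}" if "i < N" for i
    using bij_betwE[OF s] that by simp
  have card: "card (verts (diag_cube n)) = N"
    using bij_betw_same_card[OF bij_betw_indicator_vertex, of n] by (simp add: diag_cube_def N_def)
  define e where "e = (\<lambda>i. indicator_vertex n (s i))"
  have e: "bij_betw e {0..<card (verts (diag_cube n))} (verts (diag_cube n))"
    using bij_betw_trans[OF s bij_betw_indicator_vertex] unfolding card
    by (simp add: e_def comp_def diag_cube_def)
  define M where "M = D.forest_mat (arc_weight x y) t e"
  define Z :: "'r mat" where "Z = mat N N (\<lambda>(i, j). of_bool (s j \<subseteq> s i))"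
  define U where "U = mat N N (\<lambda>(i, j). zeta_conjugate x y t (s i) (s j))"
  have carrier: "M \<in> carrier_mat N N" "Z \<in> carrier_mat N N" "U \<in> carrier_mat N N"
    using D.forest_mat_carrier[of "arc_weight x y" t e] card by (simp_all add: M_def Z_def U_def)
  have "M * Z = Z * U"
  proof (rule eq_matI)
    fix i j assume "i < dim_row (Z * U)" "j < dim_col (Z * U)"
    then have ij: "i < N" "j < N"
      using carrier by auto
    \<comment> \<open>Column \<open>j\<close> of \<open>Z\<close> as a function on vertices, so that
      \<open>forest_mat_apply\<close> computes column \<open>j\<close> of
      \<open>M * Z\<close>.\<close>
    define f :: "vertex \<Rightarrow> 'r" where "f v = of_bool (\<forall>k \<in> s j. v k = 1)" for v
    have f: "f (indicator_vertex n S) = of_bool (s j \<subseteq> S)" for S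
    proof -
      have "indicator_vertex n S k = 1 \<longleftrightarrow> k \<in> S" if "k \<in> s j" for k
        using subsetD[OF sub[OF ij(2)] that] by (simp add: indicator_vertex_def)
      then show ?thesis
        by (auto simp: f_def)
    qed
    have "(M * Z) $$ (i, j) = (\<Sum>k = 0..<N. M $$ (i, k) * f (e k))"
      using ij carrier by (auto simp: scalar_prod_def e_def f Z_def intro!: sum.cong)
    also have "\<dots> = t * f (e i) + (\<Sum>a \<in> out_arcs (diag_cube n) (e i).
        arc_weight x y a * (f (e i) - f (head (diag_cube n) a)))"
      using D.forest_mat_apply[OF e, of i] ij unfolding M_def card by simp
    also have "\<dots> = t * of_bool (s j \<subseteq> s i)
        + (\<Sum>k = 1..n. x k (of_bool (k \<notin> s i)) *
            (of_bool (s j \<subseteq> s i) - of_bool (s j \<subseteq> sym_diff (s i) {k})))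
        + y * (of_bool (s j \<subseteq> s i) - of_bool (s j \<subseteq> {1..n} - s i))"
    proof -
      have head: "head (diag_cube n) (Cube u v) = v" "head (diag_cube n) (Diag u v) = v" for u v
        by (simp_all add: diag_cube_def)
      show ?thesis
        unfolding e_def sum_out_arcs_diag_cube f head add.assoc
        by (intro arg_cong2[where f = "(+)"] sum.cong refl)
          (simp_all only: arc_weight_flip arc_weight.simps(2))
    qed
    also have "\<dots> = (\<Sum>Q \<in> Pow {1..n}. of_bool (Q \<subseteq> s i) * zeta_conjugate x y t Q (s j))"
      using sub ij by (intro sum_zeta_conjugate[symmetric]) auto
    also have "\<dots> = (\<Sum>k = 0..<N. of_bool (s k \<subseteq> s i) * zeta_conjugate x y t (s k) (s j))"
      by (rule sum.reindex_bij_betw[OF s, symmetric])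
    also have "\<dots> = (Z * U) $$ (i, j)"
      using ij carrier by (auto simp: scalar_prod_def Z_def U_def intro!: sum.cong)
    finally show "(M * Z) $$ (i, j) = (Z * U) $$ (i, j)" .
  qed (use carrier in auto)
  moreover have "det Z = 1"
  proof -
    \<comment> \<open>\<open>Z\<close> is lower triangular in the chosen order; transposition makes
      the upper triangular rule applicable.\<close>
    have "det Z = det (transpose_mat Z)"
      using carrier(2) by (simp add: det_transpose)
    also have "transpose_mat Z = mat N N (\<lambda>(i, j). of_bool (s i \<subseteq> s j))"
      by (auto simp: Z_def)
    also have "det \<dots> = (\<Prod>i = 0..<N. of_bool (s i \<subseteq> s i))"
      using not_subset by (intro det_mat_upper_triangular) simp
    finally show ?thesis by simp
  qed
  ultimately have "det M = det U"
    using det_mult carrier by (metis mult.commute mult_1)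
  also have "\<dots> = (\<Prod>i = 0..<N. zeta_conjugate x y t (s i) (s i))"
    unfolding U_def
  proof (rule det_mat_upper_triangular)
    fix i j assume ij: "i < N" "j < i"
    then have "\<not> s i \<subseteq> s j"
      by (rule not_subset)
    \<comment> \<open>Every term of \<open>zeta_conjugate\<close> at \<open>Q\<close>,
      \<open>R\<close> requires \<open>Q\<close> to be a subset of \<open>R\<close>.\<close>
    then have "s i \<noteq> s j" "\<And>k. s i \<noteq> s j - {k}"
      by blast+
    with \<open>\<not> s i \<subseteq> s j\<close> show "zeta_conjugate x y t (s i) (s j) = 0"
      by (simp add: zeta_conjugate_def)
  qed
  also have "\<dots> = (\<Prod>S \<in> Pow {1..n}. zeta_conjugate x y t S S)"
    by (rule prod.reindex_bij_betw[OF s])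
  also have "\<dots> = (\<Prod>S \<in> Pow {1..n}. t + 2 * y * of_bool (odd (card S)) + (\<Sum>i \<in> S. x i 0 + x i 1))"
  proof (intro prod.cong refl)
    fix S
    have "(\<Sum>i \<in> S. of_bool (S = S - {i}) * x i 1) = 0"
      by (intro sum.neutral) auto
    then show "zeta_conjugate x y t S S =
        t + 2 * y * of_bool (odd (card S)) + (\<Sum>i \<in> S. x i 0 + x i 1)"
      \<comment> \<open>The diagonal arc leaves \<open>y\<close> minus \<open>y\<close> times the
        sign of \<open>S\<close>, that is \<open>2 * y\<close> for odd size and 0 for even
        size.\<close>
      by (cases "odd (card S)") (simp_all add: zeta_conjugate_def algebra_simps)
  qed
  finally show ?thesis
    unfolding M_def D.matrix_forest[OF e] .
qed

text \<open>The identity holds for arbitrary elements of a commutative ring, in particular for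
  indeterminates of the polynomial ring.\<close>

theorem theorem3p1:
  fixes n :: nat and t y :: "'a :: comm_ring_1 mpoly" and x :: "nat \<Rightarrow> nat \<Rightarrow> 'a mpoly"
  defines "t \<equiv> Var T" and "y \<equiv> Var Y" and "x \<equiv> \<lambda>i \<epsilon>. Var (X i \<epsilon>)"
  shows "forest_enumerator (diag_cube n) (arc_weight x y) t =
    (\<Prod>S \<in> Pow {1..n}. t + 2 * y * of_bool (odd (card S)) + (\<Sum>i \<in> S. x i 0 + x i 1))"
  unfolding t_def y_def x_def by (rule forest_enumerator_diag_cube)

end
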